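(* For every integer $d \geq 8$, there exists a bipartite graph $Q_d$ with $c_{\mathbf{UNIP}}(Q_d) = d$.
   Context: Graphs are finite, simple and have a nonempty vertex set. For a class of graphs $\mathcal{P}$, a covering of a graph $G$ by graphs of class $\mathcal{P}$ is an expression $E(G) = E(G_1) \cup \dots \cup E(G_k)$ with $k \geq 1$, where each $G_i$ is a graph on the vertex set $V(G)$ and $G_i \in \mathcal{P}$. The cover number $c_{\mathcal{P}}(G)$ is the smallest such $k$ ($\infty$ if no covering exists). A graph is unipolar if its vertex set is a disjoint union $A \cup B$ (either part possibly empty) such that $A$ induces a clique and $B$ induces a disjoint union of cliques. $c_{\mathbf{UNIP}}$ denotes the cover number by unipolar graphs. *)

theory Defs
  imports "HOL-Library.Extended_Nat" "HOL-Library.Disjoint_Sets"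
begin

definition pairs :: "'a set \<Rightarrow> 'a set set" where
  "pairs X = {e. e \<subseteq> X \<and> card e = 2}"

record 'a graph =
  verts :: "'a set"
  edges :: "'a set set"

definition fin_simple_graph :: "'a graph \<Rightarrow> bool" where
  "fin_simple_graph G \<longleftrightarrow>
     finite (verts G) \<and> verts G \<noteq> {} \<and> edges G \<subseteq> pairs (verts G)"

definition bipartite :: "'a graph \<Rightarrow> bool" where
  "bipartite G \<longleftrightarrow>
     (\<exists>X Y. X \<union> Y = verts G \<and> X \<inter> Y = {} \<and>
        (\<forall>e\<in>edges G. \<exists>x\<in>X. \<exists>y\<in>Y. e = {x, y}))"

definition induced_edges :: "'a graph \<Rightarrow> 'a set \<Rightarrow> 'a set set" where
  "induced_edges G A = {e \<in> edges G. e \<subseteq> A}"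

text \<open>The empty set induces a clique, and also a (vacuous) disjoint union of cliques.\<close>

definition induces_clique :: "'a graph \<Rightarrow> 'a set \<Rightarrow> bool" where
  "induces_clique G A \<longleftrightarrow> induced_edges G A = pairs A"

definition induces_disjoint_cliques :: "'a graph \<Rightarrow> 'a set \<Rightarrow> bool" where
  "induces_disjoint_cliques G B \<longleftrightarrow>
     (\<exists>\<C>. partition_on B \<C> \<and> induced_edges G B = (\<Union>C\<in>\<C>. pairs C))"

definition unipolar :: "'a graph \<Rightarrow> bool" where
  "unipolar G \<longleftrightarrow>
     (\<exists>A B. A \<union> B = verts G \<and> A \<inter> B = {} \<and>
        induces_clique G A \<and> induces_disjoint_cliques G B)"

definition covering :: "('a graph \<Rightarrow> bool) \<Rightarrow> 'a graph \<Rightarrow> nat \<Rightarrow> (nat \<Rightarrow> 'a graph) \<Rightarrow> bool" where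
  "covering P G k H \<longleftrightarrow>
     k \<ge> 1 \<and>
     (\<forall>i\<in>{1..k}. fin_simple_graph (H i) \<and> verts (H i) = verts G \<and> P (H i)) \<and>
     edges G = (\<Union>i\<in>{1..k}. edges (H i))"

text \<open>If no covering exists, this is the infimum of the empty set, i.e. \<open>\<infinity>\<close>.\<close>

definition cover_number :: "('a graph \<Rightarrow> bool) \<Rightarrow> 'a graph \<Rightarrow> enat" where
  "cover_number P G = Inf {enat k | k. \<exists>H. covering P G k H}"

end

theory Submission imports Defs begin

text \<open>
  The graphs are obtained by a discrete intermediate value argument. A single edge together with
  isolated vertices is unipolar, so inserting one edge into a graph raises the unipolar cover
  number by at most one (\<open>cover_number_insert_edge\<close>). The edgeless graph has cover number at most 1.
  Inserting the edges of a graph one after another therefore passes through every value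
  from 1 up to the cover number of that graph (\<open>cover_number_intermediate\<close>), and all graphs on
  the way are bipartite if the last one is. It remains to see that bipartite graphs can have
  arbitrarily large cover number.

  In a bipartite graph cliques have at most two vertices. A unipolar subgraph thus consists of
  edges meeting a set \<open>A\<close> of at most two vertices and of a matching outside \<open>A\<close>; so every vertex
  outside \<open>A\<close> has degree at most 3 in it (\<open>unipolar_subgraph_low_degree\<close>). If \<open>k\<close> such subgraphs
  cover a bipartite graph, then all but at most \<open>2k\<close> vertices have degree at most \<open>3k\<close>
  (\<open>covered_graph_low_degree\<close>). This excludes small coverings of large complete bipartite
  graphs.
\<close>

section \<open>Inserting edges one at a time\<close>

lemma cover_number_leI: "covering P G k H \<Longrightarrow> cover_number P G \<le> enat k"
  unfolding cover_number_def by (rule Inf_lower) auto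

lemma cover_number_attained:
  assumes "cover_number P G = enat k"
  obtains H where "covering P G k H"
proof -
  define S where "S = {enat k | k. \<exists>H. covering P G k H}"
  have Inf: "Inf S = enat k" using assms by (simp add: cover_number_def S_def)
  then have "S \<noteq> {}" unfolding Inf_enat_def by (metis enat.distinct(1))
  then obtain s where "s \<in> S" by blast
  then have "enat k \<in> S" using wellorder_InfI[of s S] Inf by simp
  then show thesis using that unfolding S_def by auto
qed

text \<open>
  For the edgeless graph take an empty clique part, otherwise take the edge as the clique part;
  the remaining vertices are singleton cliques.
\<close>
lemma unipolar_at_most_one_edge:
  assumes "F \<subseteq> {e}" "F \<subseteq> pairs V"
  shows "unipolar \<lparr>verts = V, edges = F\<rparr>"
proof -
  let ?A = "\<Union>F" and ?\<C> = "(\<lambda>x. {x}) ` (V - \<Union>F)"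
  have F: "F = {} \<or> (F = {e} \<and> e \<subseteq> V \<and> card e = 2)"
    using assms by (auto simp: pairs_def)
  have "pairs ?A = F"
  proof (cases "F = {}")
    case True
    then show ?thesis by (auto simp: pairs_def)
  next
    case False
    then have e: "F = {e}" "card e = 2" using F by auto
    then have "finite e" by (intro card_ge_0_finite) simp
    then have "s = e" if "s \<subseteq> e" "card s = 2" for s
      using card_subset_eq[of e s] e(2) that by simp
    then show ?thesis using e by (auto simp: pairs_def)
  qed
  then have "induces_clique \<lparr>verts = V, edges = F\<rparr> ?A"
    by (auto simp: induces_clique_def induced_edges_def)
  moreover have "induces_disjoint_cliques \<lparr>verts = V, edges = F\<rparr> (V - ?A)"
  proof -
    have "partition_on (V - ?A) ?\<C>"
      by (auto simp: partition_on_def disjoint_def)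
    moreover have "(\<Union>C\<in>?\<C>. pairs C) = {}"
      by (auto simp: pairs_def dest!: subset_singletonD)
    moreover have "induced_edges \<lparr>verts = V, edges = F\<rparr> (V - ?A) = {}"
      using F by (fastforce simp: induced_edges_def)
    ultimately show ?thesis
      unfolding induces_disjoint_cliques_def by (intro exI[of _ ?\<C>]) simp
  qed
  moreover have "?A \<union> (V - ?A) = V" "?A \<inter> (V - ?A) = {}"
    using F by auto
  ultimately show ?thesis
    unfolding unipolar_def by (intro exI[of _ ?A] exI[of _ "V - ?A"]) simp
qed

lemma cover_number_edgeless:
  assumes "finite V" "V \<noteq> {}"
  shows "cover_number unipolar \<lparr>verts = V, edges = {}\<rparr> \<le> 1"
proof -
  have "covering unipolar \<lparr>verts = V, edges = {}\<rparr> 1 (\<lambda>_. \<lparr>verts = V, edges = {}\<rparr>)"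
    using assms
    by (auto simp: covering_def fin_simple_graph_def intro: unipolar_at_most_one_edge)
  from cover_number_leI[OF this] show ?thesis by (simp add: one_enat_def)
qed

lemma cover_number_insert_edge:
  assumes V: "finite V" "V \<noteq> {}" and e: "e \<in> pairs V"
    and c: "cover_number unipolar \<lparr>verts = V, edges = F\<rparr> = enat k"
  shows "cover_number unipolar \<lparr>verts = V, edges = insert e F\<rparr> \<le> enat (Suc k)"
proof -
  obtain H where H: "covering unipolar \<lparr>verts = V, edges = F\<rparr> k H"
    using cover_number_attained[OF c] .
  let ?H = "H(Suc k := \<lparr>verts = V, edges = {e}\<rparr>)"
  have new: "fin_simple_graph \<lparr>verts = V, edges = {e}\<rparr>" "unipolar \<lparr>verts = V, edges = {e}\<rparr>"
    using V e by (auto simp: fin_simple_graph_def intro: unipolar_at_most_one_edge)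
  have "(\<Union>i\<in>{1..Suc k}. edges (?H i)) = insert e (\<Union>i\<in>{1..k}. edges (H i))"
    by (auto simp: atLeastAtMostSuc_conv)
  also have "\<dots> = insert e F"
    using H by (simp add: covering_def)
  finally have "covering unipolar \<lparr>verts = V, edges = insert e F\<rparr> (Suc k) ?H"
    using H new by (auto simp: covering_def)
  then show ?thesis by (rule cover_number_leI)
qed

text \<open>
  Induction on the edge set: either the graph without the last edge still has cover number at
  least \<open>d\<close>, or its cover number is below \<open>d\<close> and the last edge lifts it to exactly \<open>d\<close>.
\<close>
lemma cover_number_intermediate:
  assumes V: "finite V" "V \<noteq> {}" and d: "d \<ge> 1"
    and F: "finite F" "F \<subseteq> pairs V"
    and large: "enat d \<le> cover_number unipolar \<lparr>verts = V, edges = F\<rparr>"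
  obtains F' where "F' \<subseteq> F" "cover_number unipolar \<lparr>verts = V, edges = F'\<rparr> = enat d"
proof -
  have "\<exists>F'\<subseteq>F. cover_number unipolar \<lparr>verts = V, edges = F'\<rparr> = enat d"
    using F large
  proof (induction F rule: finite_induct)
    case empty
    have "cover_number unipolar \<lparr>verts = V, edges = {}\<rparr> \<le> enat d"
      using cover_number_edgeless[OF V] d
      by (metis enat_ord_simps(1) one_enat_def order_trans)
    then show ?case using empty.prems by (auto intro: antisym)
  next
    case (insert e F)
    show ?case
    proof (cases "enat d \<le> cover_number unipolar \<lparr>verts = V, edges = F\<rparr>")
      case True
      then show ?thesis using insert by blast
    next
      case False
      then obtain k where k: "cover_number unipolar \<lparr>verts = V, edges = F\<rparr> = enat k" "k < d"
        by (cases "cover_number unipolar \<lparr>verts = V, edges = F\<rparr>") auto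
      have "cover_number unipolar \<lparr>verts = V, edges = insert e F\<rparr> \<le> enat (Suc k)"
        using cover_number_insert_edge[OF V _ k(1)] insert.prems by simp
      also have "\<dots> \<le> enat d" using k(2) by simp
      finally show ?thesis using insert.prems by (blast intro: antisym)
    qed
  qed
  then show thesis using that by blast
qed

section \<open>Coverings of bipartite graphs\<close>

text \<open>A clique has at most one vertex on each side of the bipartition.\<close>
lemma bipartite_clique_card_le_2:
  assumes "bipartite G" "pairs C \<subseteq> edges G" "C \<subseteq> verts G"
  shows "card C \<le> 2"
proof -
  obtain X Y where XY: "X \<union> Y = verts G" "X \<inter> Y = {}"
      "\<And>e. e \<in> edges G \<Longrightarrow> \<exists>x\<in>X. \<exists>y\<in>Y. e = {x, y}"
    using assms(1) unfolding bipartite_def by auto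
  have same_side: "a = b" if "a \<in> C" "b \<in> C" "a \<in> X \<longleftrightarrow> b \<in> X" for a b
  proof (rule ccontr)
    assume "a \<noteq> b"
    then have "{a, b} \<in> edges G"
      using that assms(2) by (auto simp: pairs_def)
    from XY(3)[OF this] obtain x y where "x \<in> X" "y \<in> Y" "{a, b} = {x, y}" by blast
    then show False
      using that(3) XY(2) by (auto simp: doubleton_eq_iff)
  qed
  then have "inj_on (\<lambda>a. a \<in> X) C"
    by (intro inj_onI) auto
  then have "card C \<le> card (UNIV :: bool set)"
    by (rule card_inj_on_le) auto
  then show ?thesis by simp
qed

text \<open>
  A neighbour of a vertex outside \<open>A\<close> lies in \<open>A\<close> or is the other vertex of its clique; this
  leaves at most \<open>2 + 1\<close> possibilities.
\<close>
lemma unipolar_subgraph_low_degree: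
  assumes G: "bipartite G" and H: "fin_simple_graph H" "unipolar H"
    and sub: "verts H = verts G" "edges H \<subseteq> edges G"
  obtains A where "A \<subseteq> verts H" "card A \<le> 2"
    "\<And>x. x \<in> verts H - A \<Longrightarrow> card {y. {x, y} \<in> edges H} \<le> 3"
proof -
  obtain A B \<C> where AB: "A \<union> B = verts H" "A \<inter> B = {}"
      and A: "induced_edges H A = pairs A"
      and \<C>: "partition_on B \<C>" "induced_edges H B = (\<Union>C\<in>\<C>. pairs C)"
    using H(2) unfolding unipolar_def induces_clique_def induces_disjoint_cliques_def by metis
  have fin: "finite (verts H)" and edges: "edges H \<subseteq> pairs (verts H)"
    using H(1) by (auto simp: fin_simple_graph_def)
  have clique: "card C \<le> 2" if "pairs C \<subseteq> edges H" "C \<subseteq> verts H" for C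
    using bipartite_clique_card_le_2[OF G, of C] that sub by auto
  have "pairs A \<subseteq> edges H"
    using A by (auto simp: induced_edges_def)
  with clique AB(1) have cA: "card A \<le> 2" by blast
  have deg: "card {y. {x, y} \<in> edges H} \<le> 3" if x: "x \<in> verts H - A" for x
  proof -
    have "x \<in> B" using x AB by blast
    then obtain C where C: "C \<in> \<C>" "x \<in> C"
      using \<C>(1) by (auto simp: partition_on_def)
    have CB: "C \<subseteq> B" using C(1) \<C>(1) by (auto simp: partition_on_def)
    have "pairs C \<subseteq> edges H"
      using C(1) \<C>(2) by (auto simp: induced_edges_def)
    with clique CB AB(1) have cC: "card C \<le> 2" by blast
    have "{y. {x, y} \<in> edges H} \<subseteq> A \<union> (C - {x})"
    proof
      fix y assume "y \<in> {y. {x, y} \<in> edges H}"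
      then have xy: "{x, y} \<in> edges H" by simp
      then have y: "y \<in> verts H" "y \<noteq> x"
        using edges by (auto simp: pairs_def)
      show "y \<in> A \<union> (C - {x})"
      proof (cases "y \<in> A")
        case False
        then have "{x, y} \<in> induced_edges H B"
          using xy y AB \<open>x \<in> B\<close> by (auto simp: induced_edges_def)
        then obtain D where D: "D \<in> \<C>" "{x, y} \<subseteq> D"
          using \<C>(2) by (auto simp: pairs_def)
        then have "D = C"
          using C \<C>(1) by (auto simp: partition_on_def disjoint_def)
        then show ?thesis using D y by auto
      qed simp
    qed
    moreover have "finite A" "finite C"
      using AB(1) CB fin by (auto intro: finite_subset)
    ultimately have "card {y. {x, y} \<in> edges H} \<le> card (A \<union> (C - {x}))"
      by (intro card_mono) auto
    also have "\<dots> \<le> card A + card (C - {x})" by (rule card_Un_le)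
    also have "\<dots> \<le> 3" using cA cC C(2) \<open>finite C\<close> by simp
    finally show ?thesis .
  qed
  show thesis using that[of A] AB cA deg by blast
qed

text \<open>
  The exceptional set is the union of those of the \<open>k\<close> subgraphs; outside it each subgraph
  contributes at most 3 to the degree.
\<close>
lemma covered_graph_low_degree:
  assumes G: "bipartite G" and cov: "covering unipolar G k H"
  obtains A where "finite A" "card A \<le> 2 * k"
    "\<And>x. x \<in> verts G - A \<Longrightarrow> card {y. {x, y} \<in> edges G} \<le> 3 * k"
proof -
  have H: "fin_simple_graph (H i)" "verts (H i) = verts G" "unipolar (H i)"
      "edges (H i) \<subseteq> edges G" if "i \<in> {1..k}" for i
    using cov that by (auto simp: covering_def)
  have union: "edges G = (\<Union>i\<in>{1..k}. edges (H i))"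
    using cov by (simp add: covering_def)
  have "\<exists>A. A \<subseteq> verts G \<and> card A \<le> 2 \<and>
      (\<forall>x\<in>verts G - A. card {y. {x, y} \<in> edges (H i)} \<le> 3)" if i: "i \<in> {1..k}" for i
    by (rule unipolar_subgraph_low_degree[OF G H(1)[OF i] H(3)[OF i] H(2)[OF i] H(4)[OF i]])
      (use H(2)[OF i] in auto)
  then obtain A where A: "\<And>i. i \<in> {1..k} \<Longrightarrow> A i \<subseteq> verts G"
      "\<And>i. i \<in> {1..k} \<Longrightarrow> card (A i) \<le> 2"
      "\<And>i x. i \<in> {1..k} \<Longrightarrow> x \<in> verts G - A i \<Longrightarrow> card {y. {x, y} \<in> edges (H i)} \<le> 3"
    by metis
  let ?A = "\<Union>i\<in>{1..k}. A i"
  have "finite ?A"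
  proof (rule finite_UN_I)
    fix i assume i: "i \<in> {1..k}"
    then have "finite (verts G)"
      using H(1,2)[OF i] by (simp add: fin_simple_graph_def)
    with A(1)[OF i] show "finite (A i)" by (rule finite_subset)
  qed simp
  moreover have "card ?A \<le> 2 * k"
  proof -
    have "card ?A \<le> (\<Sum>i\<in>{1..k}. card (A i))" by (rule card_UN_le) simp
    also have "\<dots> \<le> (\<Sum>i\<in>{1..k}. 2)" by (rule sum_mono) (rule A(2))
    finally show ?thesis by simp
  qed
  moreover have "card {y. {x, y} \<in> edges G} \<le> 3 * k" if x: "x \<in> verts G - ?A" for x
  proof -
    have "{y. {x, y} \<in> edges G} = (\<Union>i\<in>{1..k}. {y. {x, y} \<in> edges (H i)})"
      using union by auto
    then have "card {y. {x, y} \<in> edges G} \<le> (\<Sum>i\<in>{1..k}. card {y. {x, y} \<in> edges (H i)})"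
      using card_UN_le[of "{1..k}"] by simp
    also have "\<dots> \<le> (\<Sum>i\<in>{1..k}. 3)" by (rule sum_mono) (use A(3) x in auto)
    finally show ?thesis by simp
  qed
  ultimately show thesis using that by blast
qed

section \<open>Complete bipartite graphs\<close>

definition complete_bipartite_edges :: "'a set \<Rightarrow> 'a set \<Rightarrow> 'a set set" where
  "complete_bipartite_edges X Y = {{x, y} | x y. x \<in> X \<and> y \<in> Y}"

lemma bipartite_subset_complete:
  assumes "X \<inter> Y = {}" "F \<subseteq> complete_bipartite_edges X Y"
  shows "bipartite \<lparr>verts = X \<union> Y, edges = F\<rparr>"
proof -
  have "\<exists>x\<in>X. \<exists>y\<in>Y. e = {x, y}" if "e \<in> F" for e
    using assms(2) that unfolding complete_bipartite_edges_def by blast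
  then show ?thesis
    unfolding bipartite_def using assms(1) by (intro exI[of _ X] exI[of _ Y]) simp
qed

text \<open>
  The side \<open>X\<close> is too large to be contained in the exceptional set of a covering by fewer than \<open>d\<close>
  graphs, and the remaining vertices of \<open>X\<close> have too many neighbours.
\<close>
lemma complete_bipartite_cover_number:
  assumes XY: "X \<inter> Y = {}" "card X \<ge> 2 * d" "card Y \<ge> 3 * d"
  shows "enat d \<le> cover_number unipolar \<lparr>verts = X \<union> Y, edges = complete_bipartite_edges X Y\<rparr>"
    (is "_ \<le> cover_number _ ?K")
proof (rule ccontr)
  assume "\<not> ?thesis"
  then obtain k where k: "cover_number unipolar ?K = enat k" "k < d"
    by (cases "cover_number unipolar ?K") auto
  obtain H where "covering unipolar ?K k H"
    using cover_number_attained[OF k(1)] .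
  then obtain A where A: "finite A" "card A \<le> 2 * k"
      "\<And>x. x \<in> X \<union> Y - A \<Longrightarrow> card {y. {x, y} \<in> edges ?K} \<le> 3 * k"
    using covered_graph_low_degree[OF bipartite_subset_complete[OF XY(1) order_refl]]
    by (metis graph.select_convs(1))
  have "\<not> X \<subseteq> A"
    using card_mono[OF A(1), of X] A(2) XY(2) k(2) by linarith
  then obtain x where x: "x \<in> X" "x \<notin> A" by blast
  have "{y. {x, y} \<in> edges ?K} = Y"
    using x(1) XY(1) by (auto simp: complete_bipartite_edges_def doubleton_eq_iff)
  then show False
    using A(3)[of x] x XY(3) k(2) by simp
qed

theorem theorem11:
  fixes d :: nat
  assumes "d \<ge> 8"
  shows "\<exists>Q :: nat graph.
    fin_simple_graph Q \<and> bipartite Q \<and> cover_number unipolar Q = enat d"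
proof -
  let ?X = "{..<2 * d}" and ?Y = "{2 * d..<5 * d}"
  let ?V = "?X \<union> ?Y" and ?K = "complete_bipartite_edges ?X ?Y"
  have disj: "?X \<inter> ?Y = {}" by auto
  have V: "finite ?V" "?V \<noteq> {}" using assms by auto
  have K: "?K \<subseteq> pairs ?V" by (auto simp: complete_bipartite_edges_def pairs_def)
  moreover have "finite (pairs ?V)"
    using V(1) by (auto simp: pairs_def)
  ultimately have "finite ?K" by (rule finite_subset)
  moreover have "enat d \<le> cover_number unipolar \<lparr>verts = ?V, edges = ?K\<rparr>"
    by (rule complete_bipartite_cover_number[OF disj]) auto
  moreover have "d \<ge> 1" using assms by simp
  ultimately obtain F where F: "F \<subseteq> ?K" "cover_number unipolar \<lparr>verts = ?V, edges = F\<rparr> = enat d"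
    using cover_number_intermediate[OF V _ _ K] by blast
  have "fin_simple_graph \<lparr>verts = ?V, edges = F\<rparr>"
    using V F(1) K by (auto simp: fin_simple_graph_def)
  then show ?thesis
    using bipartite_subset_complete[OF disj F(1)] F(2) by blast
qed

end
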